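(* Let $M$ be a dichotomic surface. Then $M$ is intransitive, i.e. no flow on $M$ has a dense orbit.
   Context: A surface is a connected Hausdorff topological $2$-manifold without boundary, not assumed metrizable. A surface $M$ is dichotomic if $M-J$ is disconnected for every subset $J\subset M$ homeomorphic to the circle. A flow on $M$ is a continuous action $f\colon\mathbb{R}\times M\to M$ of the additive group $\mathbb{R}$; the orbit of $x$ is $f(\mathbb{R}\times\{x\})$. A flow is transitive if it has at least one dense orbit; a space admitting no transitive flow is intransitive. *)

theory Defs
  imports "HOL-Analysis.Analysis"
begin

text \<open>Spaces are abstract topologies, so that the underlying set may be any subset of a type.
  No countability or metrizability is required of a surface. The library counts the empty space
  as connected; it is harmless to allow it, since it contains no orbit.\<close>

definition surface :: "'a topology \<Rightarrow> bool" where
  "surface M \<longleftrightarrow> connected_space M \<and> Hausdorff_space M \<and>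
     (\<forall>x \<in> topspace M. \<exists>U. openin M U \<and> x \<in> U \<and>
        subtopology M U homeomorphic_space (euclidean :: (real^2) topology))"

definition dichotomic :: "'a topology \<Rightarrow> bool" where
  "dichotomic M \<longleftrightarrow>
     (\<forall>J. J \<subseteq> topspace M \<and>
          subtopology M J homeomorphic_space top_of_set (sphere (0 :: real^2) 1) \<longrightarrow>
          \<not> connectedin M (topspace M - J))"

definition flow_on :: "'a topology \<Rightarrow> (real \<times> 'a \<Rightarrow> 'a) \<Rightarrow> bool" where
  "flow_on M f \<longleftrightarrow> continuous_map (prod_topology euclideanreal M) M f \<and>
     (\<forall>x \<in> topspace M. f (0, x) = x) \<and>
     (\<forall>s t. \<forall>x \<in> topspace M. f (s + t, x) = f (s, f (t, x)))"

definition flow_orbit :: "(real \<times> 'a \<Rightarrow> 'a) \<Rightarrow> 'a \<Rightarrow> 'a set" where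
  "flow_orbit f x = f ` (UNIV \<times> {x})"

definition transitive_flow :: "'a topology \<Rightarrow> (real \<times> 'a \<Rightarrow> 'a) \<Rightarrow> bool" where
  "transitive_flow M f \<longleftrightarrow> flow_on M f \<and>
     (\<exists>x \<in> topspace M. M closure_of (flow_orbit f x) = topspace M)"

definition intransitive :: "'a topology \<Rightarrow> bool" where
  "intransitive M \<longleftrightarrow> (\<nexists>f. transitive_flow M f)"

end

theory Submission imports Defs begin

text \<open>Near a point moved by the flow there is a local section, an arc whose flow box is an
  open embedding of a rectangle (Whitney, Bebutov). A dense orbit crosses the arc infinitely
  often, so it is not periodic. Two consecutive crossings bound a piece of the orbit, which
  together with the segment of the arc between them forms a circle; this circle separates the
  surface. All crossings of the segment go through it in the same direction, so the orbit
  after the second crossing stays on the side above the segment, and the orbit before the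
  first crossing stays on the side below it. If these sides agree, the orbit misses the other
  side; if they differ, the orbit never crosses the segment again. Both contradict density.\<close>


text \<open>The flow is merely continuous, so there is no vector field to which a section could be
  taken transverse. Integration along orbits replaces it: for a suitable function the integral over
  a moving time window is strictly increasing in the position of the window. The level set obtained
  in this way is not shown to be a curve; an arc is found in the projection of a disc along orbits,
  and invariance of domain makes the box over this arc open. Dichotomy gives only some splitting of
  the complement of the circle into two nonempty open sets, without telling which points of the
  circle they border. Two strips link this splitting to the flow: points reached from the segment in
  short positive time, and points reached in short negative time. Each strip is connected and misses
  the circle, so it lies in one part. Statements about the past of an orbit are those about the
  future, applied to the reversed flow.\<close>

section \<open>Flow laws, charts and a bump function\<close>

lemma flow_on_add:
  assumes "flow_on M f" "x \<in> topspace M"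
  shows "f (s, f (t, x)) = f (s + t, x)"
  using assms by (simp add: flow_on_def)

lemma flow_on_zero:
  assumes "flow_on M f" "x \<in> topspace M"
  shows "f (0, x) = x"
  using assms by (simp add: flow_on_def)

lemma flow_on_continuous_map:
  assumes "flow_on M f" "continuous_map X euclideanreal u" "continuous_map X M v"
  shows "continuous_map X M (\<lambda>y. f (u y, v y))"
proof -
  have "continuous_map X (prod_topology euclideanreal M) (\<lambda>y. (u y, v y))"
    using assms by (simp add: continuous_map_pairedI)
  then show ?thesis
    using assms(1) continuous_map_compose[of X _ "\<lambda>y. (u y, v y)" M f]
    by (simp add: flow_on_def o_def)
qed

lemma flow_on_in_topspace:
  assumes "flow_on M f" "x \<in> topspace M"
  shows "f (t, x) \<in> topspace M"
  using assms unfolding flow_on_def continuous_map_def by auto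

lemma surface_chart:
  assumes "surface M" "x \<in> topspace M"
  obtains k :: "real^2 \<Rightarrow> 'a" where "continuous_map euclidean M k" "open_map euclidean M k"
    "inj k" "x \<in> range k"
proof -
  obtain U where U: "openin M U" "x \<in> U"
    "subtopology M U homeomorphic_space (euclidean :: (real^2) topology)"
    using assms unfolding surface_def by blast
  then obtain h k where hk: "homeomorphic_maps (subtopology M U) (euclidean :: (real^2) topology) h k"
    unfolding homeomorphic_space_def by blast
  have UM: "U \<subseteq> topspace M" using U(1) openin_subset by blast
  have khz: "h (k z) = z" for z using hk by (auto simp: homeomorphic_maps_def)
  have khx: "k (h y) = y" if "y \<in> U" for y
    using hk that UM by (auto simp: homeomorphic_maps_def)
  have "continuous_map euclidean (subtopology M U) k"
    using hk by (simp add: homeomorphic_maps_def)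
  then have 1: "continuous_map euclidean M k"
    by (simp add: continuous_map_in_subtopology)
  have "homeomorphic_map euclidean (subtopology M U) k"
    using hk homeomorphic_maps_map by blast
  then have "open_map euclidean (subtopology M U) k"
    by (rule homeomorphic_imp_open_map)
  then have 2: "open_map euclidean M k"
    using U(1) by (simp add: open_map_def openin_open_subtopology)
  have 3: "inj k" by (rule inj_on_inverseI[where g=h]) (rule khz)
  have "x \<in> range k" using khx[OF U(2)] by (metis rangeI)
  with 1 2 3 show ?thesis using that by blast
qed

lemma open_embedding_inv_continuous_map:
  assumes "continuous_map euclidean M k" "open_map euclidean M k" "inj k"
  shows "continuous_map (subtopology M (range k)) euclidean (inv k)"
proof -
  have "openin (subtopology M (range k)) {x \<in> topspace M \<inter> range k. inv k x \<in> U}" if "open U" for U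
  proof -
    have "k ` UNIV \<subseteq> topspace M" using assms(1) by (auto simp: continuous_map_def)
    then have "{x \<in> topspace M \<inter> range k. inv k x \<in> U} = k ` U \<inter> range k"
      using assms(3) by (auto simp: inv_f_f dest: injD)
    moreover have "openin M (k ` U)" using assms(2) that by (simp add: open_map_def)
    ultimately show ?thesis by (simp add: openin_subtopology_Int)
  qed
  then show ?thesis by (simp add: continuous_map_def)
qed

text \<open>Because the function is defined on the whole surface, it can be integrated along orbits
  that leave the chart.\<close>

lemma chart_bump:
  fixes k :: "real^2 \<Rightarrow> 'a"
  assumes "Hausdorff_space M" "continuous_map euclidean M k" "open_map euclidean M k" "inj k"
  obtains g where "continuous_map M euclideanreal g" "g (k p) = 0"
    "\<And>y. y \<noteq> k p \<Longrightarrow> g y > 0"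
proof -
  \<comment> \<open>Capping the distance at 1 lets the function continue as the constant 1 off the
    chart: the image of the closed unit ball is compact, hence closed in a Hausdorff space, and
    outside it the cap is attained.\<close>
  define g where "g = (\<lambda>y. if y \<in> range k then min 1 (dist (inv k y) p) else 1)"
  have gk: "g (k z) = min 1 (dist z p)" for z
    using assms(4) by (simp add: g_def)
  have kM: "range k \<subseteq> topspace M" using assms(2) by (auto simp: continuous_map_def)
  have "compactin M (k ` cball p 1)"
    using image_compactin[OF _ assms(2)] by (simp add: compactin_euclidean_iff)
  then have cl: "closedin M (k ` cball p 1)"
    using assms(1) compactin_imp_closedin by blast
  have V2: "g y = 1" if "y \<notin> k ` cball p 1" for y
  proof (cases "y \<in> range k")
    case True
    then obtain z where z: "y = k z" by blast
    then have "z \<notin> cball p 1" using that by blast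
    then show ?thesis by (simp add: z gk dist_commute)
  qed (simp add: g_def)
  have "openin M {y \<in> topspace M. g y \<in> U}" if "open U" for U
  proof -
    have "open {z. min 1 (dist z p) \<in> U}"
      using open_vimage[OF that, of "\<lambda>z. min 1 (dist z p)"]
      by (simp add: vimage_def continuous_on_min continuous_on_dist)
    then have 1: "openin M (k ` {z. min 1 (dist z p) \<in> U})"
      using assms(3) by (simp add: open_map_def)
    have 2: "openin M (if 1 \<in> U then topspace M - k ` cball p 1 else {})"
      using cl by (simp add: openin_diff)
    have "{y \<in> topspace M. g y \<in> U} = k ` {z. min 1 (dist z p) \<in> U} \<union>
      (if 1 \<in> U then topspace M - k ` cball p 1 else {})" (is "?L = ?R")
    proof (rule set_eqI)
      fix y
      show "y \<in> ?L \<longleftrightarrow> y \<in> ?R"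
      proof (cases "y \<in> range k")
        case True
        then obtain z where z: "y = k z" by blast
        have "k z \<in> topspace M" using kM by blast
        then show ?thesis
          using assms(4) V2[of y] by (auto simp: z gk inj_image_mem_iff simp del: mem_cball)
      next
        case False
        then have "y \<notin> k ` S" for S by blast
        then show ?thesis using V2[of y] by (auto simp del: mem_cball)
      qed
    qed
    then show ?thesis using openin_Un[OF 1 2] by (simp only:)
  qed
  then have "continuous_map M euclideanreal g" by (simp add: continuous_map_def)
  moreover have "g (k p) = 0" by (simp add: gk)
  moreover have "g y > 0" if "y \<noteq> k p" for y
  proof (cases "y \<in> range k")
    case True
    then obtain z where z: "y = k z" by blast
    then show ?thesis using that by (auto simp: gk)
  qed (simp add: g_def)
  ultimately show ?thesis using that by blast
qed


section \<open>Local sections as level sets of an integral over a time window\<close>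

text \<open>Splitting the integral of \<open>h\<close> over \<open>{u..v+T}\<close> at
  \<open>u+T\<close> and at \<open>v\<close> shows that the windows starting at \<open>v\<close> and
  at \<open>u\<close> differ by the integral of \<open>h (s + T) - h s\<close> over
  \<open>{u..v}\<close>.\<close>

lemma integral_window_strict_mono:
  fixes h :: "real \<Rightarrow> real"
  assumes h: "continuous_on UNIV h" and "T > 0" "u < v" and less: "\<And>s. s \<in> {u..v} \<Longrightarrow> h s < h (s + T)"
  shows "integral {0..T} (\<lambda>s. h (s + u)) < integral {0..T} (\<lambda>s. h (s + v))"
proof -
  have int: "h integrable_on {a..b}" for a b
    by (rule integrable_continuous_real) (rule continuous_on_subset[OF h], simp)
  have shift: "integral {a..b} (\<lambda>s. h (s + c)) = integral {a+c..b+c} h" for a b c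
    using integral_shift_Icc_real[of a b h c] by (simp add: o_def add.commute)
  have comb: "integral {a..c} h + integral {c..b} h = integral {a..b} h" if "a \<le> c" "c \<le> b" for a b c
    using Henstock_Kurzweil_Integration.integral_combine[OF that int] .
  have "integral {u..u+T} h + integral {u+T..v+T} h = integral {u..v} h + integral {v..v+T} h"
    using comb[of u "u+T" "v+T"] comb[of u v "v+T"] assms by simp
  moreover have "integral {u..v} h < integral {u..v} (\<lambda>s. h (s + T))"
  proof (rule integral_less_real)
    show "continuous_on {u..v} h" by (rule continuous_on_subset[OF h]) simp
    show "continuous_on {u..v} (\<lambda>s. h (s + T))"
      by (rule continuous_on_compose2[OF h]) (auto intro!: continuous_intros)
  qed (use assms in auto)
  ultimately have "integral {u..u+T} h < integral {v..v+T} h"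
    using shift[of u v T] by linarith
  then show ?thesis using shift[of 0 T u] shift[of 0 T v] by (simp add: add.commute)
qed

text \<open>Strict monotonicity makes the solution unique, so the graph of \<open>\<tau>\<close> is
  the whole solution set in \<open>S \<times> {-e..e}\<close>. This set is closed and the interval
  is compact, which gives continuity.\<close>

lemma continuous_on_implicit_mono:
  fixes \<Psi> :: "real \<times> 'b::euclidean_space \<Rightarrow> real"
  assumes cont: "continuous_on UNIV \<Psi>"
    and mono: "\<And>z u v. z \<in> S \<Longrightarrow> - e \<le> u \<Longrightarrow> u < v \<Longrightarrow> v \<le> e \<Longrightarrow> \<Psi> (u, z) < \<Psi> (v, z)"
    and ends: "\<And>z. z \<in> S \<Longrightarrow> \<Psi> (-e, z) < c \<and> c < \<Psi> (e, z)" and "e > 0"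
  obtains \<tau> where "continuous_on S \<tau>" "\<tau> ` S \<subseteq> {-e..e}" "\<And>z. z \<in> S \<Longrightarrow> \<Psi> (\<tau> z, z) = c"
proof -
  have "\<exists>u. -e \<le> u \<and> u \<le> e \<and> \<Psi> (u, z) = c" if "z \<in> S" for z
  proof (rule IVT')
    show "continuous_on {-e..e} (\<lambda>u. \<Psi> (u, z))"
      by (rule continuous_on_compose2[OF cont]) (auto intro!: continuous_intros)
  qed (use ends[OF that] \<open>e > 0\<close> in auto)
  then obtain \<tau> where \<tau>: "\<And>z. z \<in> S \<Longrightarrow> -e \<le> \<tau> z \<and> \<tau> z \<le> e \<and> \<Psi> (\<tau> z, z) = c"
    by metis
  have uniq: "u = \<tau> z" if "z \<in> S" "-e \<le> u" "u \<le> e" "\<Psi> (u, z) = c" for u z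
    using mono[of z u "\<tau> z"] mono[of z "\<tau> z" u] \<tau>[OF that(1)] that by (metis less_irrefl linorder_cases)
  have fim: "\<tau> \<in> S \<rightarrow> {-e..e}" using \<tau> by auto
  have "(\<lambda>z. (z, \<tau> z)) ` S = (S \<times> {-e..e}) \<inter> (\<lambda>w. \<Psi> (snd w, fst w)) -` {c}"
    using \<tau> uniq by force
  moreover have "closedin (top_of_set (S \<times> {-e..e})) ((S \<times> {-e..e}) \<inter> (\<lambda>w. \<Psi> (snd w, fst w)) -` {c})"
    by (intro continuous_closedin_preimage continuous_on_compose2[OF cont])
       (auto intro!: continuous_intros)
  ultimately have "continuous_on S \<tau>"
    using continuous_closed_graph_eq[OF compact_Icc fim] by simp
  then show ?thesis using that \<tau> by (metis atLeastAtMost_iff image_subsetI)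
qed

lemma open_prod_cube:
  fixes S :: "(real \<times> 'b::metric_space) set"
  assumes "open S" "(0, p) \<in> S"
  shows "\<exists>d>0. \<forall>u z. \<bar>u\<bar> \<le> d \<longrightarrow> dist p z < d \<longrightarrow> (u, z) \<in> S"
proof -
  obtain A B where AB: "open A" "open B" "0 \<in> A" "p \<in> B" "A \<times> B \<subseteq> S"
    using open_prod_elim[OF assms] by (metis mem_Sigma_iff)
  obtain a where a: "a > 0" "cball 0 a \<subseteq> A" using AB open_contains_cball by blast
  obtain b where b: "b > 0" "ball p b \<subseteq> B" using AB open_contains_ball by blast
  show ?thesis
  proof (intro exI[of _ "min a b"] conjI allI impI)
    show "min a b > 0" using a b by simp
    fix u z assume "\<bar>u\<bar> \<le> min a b" "dist p z < min a b"
    then have "u \<in> cball 0 a" "z \<in> ball p b" by auto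
    then show "(u, z) \<in> S" using a(2) b(2) AB(5) by blast
  qed
qed

lemma exists_local_section:
  assumes surf: "surface M" and flow: "flow_on M f" and x: "x \<in> topspace M" and move: "f (t, x) \<noteq> x"
  obtains A e where "e > (0::real)" "continuous_map (top_of_set {0..1::real}) M A"
    "inj_on (\<lambda>(s, t). f (t, A s)) ({0..1} \<times> {-e..e})"
    "\<And>S. open S \<Longrightarrow> S \<subseteq> {0<..<1} \<times> {-e<..<e} \<Longrightarrow> openin M ((\<lambda>(s, t). f (t, A s)) ` S)"
proof -
  have haus: "Hausdorff_space M" using surf by (simp add: surface_def)
  obtain k :: "real^2 \<Rightarrow> 'a" where k: "continuous_map euclidean M k" "open_map euclidean M k"
    "inj k" "x \<in> range k"
    using surface_chart[OF surf x] by blast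
  then obtain p where p: "x = k p" by blast
  obtain g where g: "continuous_map M euclideanreal g" "g (k p) = 0" "\<And>y. y \<noteq> k p \<Longrightarrow> g y > 0"
    using chart_bump[OF haus k(1-3)] by blast
  have kM: "k z \<in> topspace M" for z using k(1) by (auto simp: continuous_map_def)
  have ik: "inv k (k z) = z" for z using k(3) by simp
  have openk: "openin M (k ` S)" if "open S" for S
    using k(2) that by (simp add: open_map_def)
  define \<Phi> where "\<Phi> = (\<lambda>w. f (fst w, k (snd w)))"
  have contk: "continuous_map (euclidean :: (real \<times> (real^2)) topology) M (\<lambda>w. k (snd w))"
    using continuous_map_compose[OF _ k(1), of euclidean snd] by (simp add: o_def continuous_on_snd)
  have \<Phi>: "continuous_map euclidean M \<Phi>"
    unfolding \<Phi>_def by (rule flow_on_continuous_map[OF flow _ contk]) (simp add: continuous_on_fst)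
  define H where "H = (\<lambda>w. g (\<Phi> w))"
  have contH: "continuous_on UNIV H"
    using continuous_map_compose[OF \<Phi> g(1)] by (simp add: H_def o_def)
  \<comment> \<open>The window needs a positive length; a point moved in time \<open>t\<close> is
    also moved in time \<open>-t\<close>.\<close>
  define T where "T = \<bar>t\<bar>"
  have "f (-t, x) \<noteq> x"
  proof
    assume "f (-t, x) = x"
    then have "f (t, x) = f (t, f (-t, x))" by simp
    also have "\<dots> = x" using flow_on_add[OF flow x] flow_on_zero[OF flow x] by simp
    finally show False using move by simp
  qed
  then have Tx: "f (T, x) \<noteq> x" using move by (auto simp: T_def abs_if)
  then have "T \<noteq> 0" using flow_on_zero[OF flow x] by metis
  then have T0: "T > 0" by (simp add: T_def)
  \<comment> \<open>The inequality holds at \<open>(0, p)\<close> because \<open>g\<close> vanishes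
    only at \<open>x\<close> and time \<open>T\<close> moves \<open>x\<close>; it is what makes the
    window integral increase. The second condition keeps short orbit pieces in the chart.\<close>
  define O1 where "O1 = {w. H w < H (fst w + T, snd w)} \<inter> \<Phi> -` range k"
  have "open (\<Phi> -` range k)"
    using openin_continuous_map_preimage[OF \<Phi> openk[OF open_UNIV]] by (simp add: vimage_def)
  moreover have "open {w. H w < H (fst w + T, snd w)}"
    by (intro open_Collect_less contH continuous_on_compose2[OF contH] continuous_intros) auto
  ultimately have O1: "open O1" unfolding O1_def by blast
  have "(0, p) \<in> O1"
    using Tx flow_on_zero[OF flow x] g(3)[of "f (T, k p)"] g(2) by (simp add: O1_def H_def \<Phi>_def p)
  then obtain d where d: "d > 0" "\<And>u z. \<bar>u\<bar> \<le> d \<Longrightarrow> dist p z < d \<Longrightarrow> (u, z) \<in> O1"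
    using open_prod_cube[OF O1] by blast
  \<comment> \<open>The section is a level set of the integral of g over an orbit piece of duration T: along
    the orbit of p this integral has derivative g at time T minus g at time 0, which is positive.\<close>
  define \<Psi> where "\<Psi> = (\<lambda>w. integral {0..T} (\<lambda>s. H (s + fst w, snd w)))"
  have cont\<Psi>: "continuous_on UNIV \<Psi>"
  proof -
    have "continuous_on (UNIV \<times> cbox 0 T) (\<lambda>(w, s). H (s + fst w, snd w))"
      unfolding split_def
      by (intro continuous_on_compose2[OF contH] continuous_intros) auto
    from integral_continuous_on_param[OF this] show ?thesis by (simp add: \<Psi>_def)
  qed
  have mono: "\<Psi> (u, z) < \<Psi> (v, z)" if "-d \<le> u" "u < v" "v \<le> d" "dist p z < d" for u v z
  proof -
    have "integral {0..T} (\<lambda>s. H (s + u, z)) < integral {0..T} (\<lambda>s. H (s + v, z))"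
    proof (rule integral_window_strict_mono[of "\<lambda>s. H (s, z)"])
      show "continuous_on UNIV (\<lambda>s. H (s, z))"
        by (rule continuous_on_compose2[OF contH]) (auto intro!: continuous_intros)
      show "H (s, z) < H (s + T, z)" if "s \<in> {u..v}" for s
        using d(2)[of s z] that \<open>-d \<le> u\<close> \<open>v \<le> d\<close> \<open>dist p z < d\<close> by (auto simp: O1_def)
    qed (use T0 that in auto)
    then show ?thesis by (simp add: \<Psi>_def)
  qed
  \<comment> \<open>Flowing the base point shifts the window. Hence along one orbit the level
    determines the time, as far as monotonicity reaches.\<close>
  have cocycle: "\<Psi> (v, z') = \<Psi> (v + u, z)" if "k z' = f (u, k z)" for u v z z'
  proof -
    have "H (s + v, z') = H (s + (v + u), z)" for s
      using flow_on_add[OF flow kM] by (simp add: H_def \<Phi>_def that add.assoc)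
    then show ?thesis by (simp add: \<Psi>_def)
  qed
  define c where "c = \<Psi> (0, p)"
  have O2: "open (\<Phi> -` (k ` ball p d))"
    using openin_continuous_map_preimage[OF \<Phi> openk[OF open_ball]] by (simp add: vimage_def)
  have "(0, p) \<in> \<Phi> -` (k ` ball p d)"
    using flow_on_zero[OF flow x] d(1) by (simp add: \<Phi>_def p)
  then obtain d' where d'0: "d' > 0"
    "\<And>u z. \<bar>u\<bar> \<le> d' \<Longrightarrow> dist p z < d' \<Longrightarrow> (u, z) \<in> \<Phi> -` (k ` ball p d)"
    using open_prod_cube[OF O2] by blast
  note d' = d'0(1) vimageD[OF d'0(2)]
  \<comment> \<open>Two times in \<open>{-e..e}\<close> differ by at most \<open>2 * e\<close>,
    which must stay within \<open>d\<close> for monotonicity; the bound \<open>d'\<close> keeps the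
    projections below in the image of the ball of radius \<open>d\<close>.\<close>
  define e where "e = min (d / 2) d'"
  have e: "e > 0" "e \<le> d / 2" "e \<le> d'" using d(1) d'(1) by (auto simp: e_def)
  define O3 where "O3 = {z. \<Psi> (-e, z) < c} \<inter> {z. c < \<Psi> (e, z)} \<inter> ball p e"
  have "open O3"
    unfolding O3_def
    by (intro open_Int open_Collect_less open_ball continuous_on_compose2[OF cont\<Psi>] continuous_intros) auto
  moreover have "p \<in> O3"
    using mono[of "-e" 0 p] mono[of 0 e p] e d(1) by (auto simp: O3_def c_def)
  ultimately obtain r where r: "r > 0" "ball p r \<subseteq> O3" using open_contains_ball by blast
  have rz: "dist p z < e" "\<Psi> (-e, z) < c" "c < \<Psi> (e, z)" if "z \<in> ball p r" for z
    using that r(2) by (auto simp: O3_def subset_iff)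
  obtain \<tau> where \<tau>: "continuous_on (ball p r) \<tau>" "\<tau> ` ball p r \<subseteq> {-e..e}"
    "\<And>z. z \<in> ball p r \<Longrightarrow> \<Psi> (\<tau> z, z) = c"
  proof (rule continuous_on_implicit_mono[OF cont\<Psi>, of "ball p r" e c])
    show "\<Psi> (u, z) < \<Psi> (v, z)" if "z \<in> ball p r" "-e \<le> u" "u < v" "v \<le> e" for z u v
      using mono[of u v z] rz(1)[OF that(1)] that e d(1) by auto
  qed (use rz e in auto)
  define q where "q = (\<lambda>z. inv k (\<Phi> (\<tau> z, z)))"
  have \<tau>e: "\<bar>\<tau> z\<bar> \<le> e" if "z \<in> ball p r" for z using \<tau>(2) that by force
  have \<Phi>\<tau>: "\<Phi> (\<tau> z, z) \<in> k ` ball p d" if "z \<in> ball p r" for z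
    using d'(2)[of "\<tau> z" z] \<tau>e[OF that] rz(1)[OF that] e by auto
  have kq: "k (q z) = f (\<tau> z, k z)" and qd: "q z \<in> ball p d" if "z \<in> ball p r" for z
    using \<Phi>\<tau>[OF that] by (auto simp: q_def ik \<Phi>_def)
  have q\<Psi>: "\<Psi> (0, q z) = c" if "z \<in> ball p r" for z
    using cocycle[OF kq[OF that], of 0] \<tau>(3)[OF that] by simp
  have contq: "continuous_on (ball p r) q"
  proof -
    have "continuous_on (ball p r) (\<lambda>z. (\<tau> z, z))" using \<tau>(1) by (intro continuous_intros)
    then have "continuous_map (top_of_set (ball p r)) M (\<lambda>z. \<Phi> (\<tau> z, z))"
      using continuous_map_compose[OF _ \<Phi>, of "top_of_set (ball p r)" "\<lambda>z. (\<tau> z, z)"] by (simp add: o_def)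
    then have "continuous_map (top_of_set (ball p r)) (subtopology M (range k)) (\<lambda>z. \<Phi> (\<tau> z, z))"
      using \<Phi>\<tau> by (fastforce simp: continuous_map_in_subtopology)
    from continuous_map_compose[OF this open_embedding_inv_continuous_map[OF k(1-3)]]
    show ?thesis by (simp add: q_def o_def)
  qed
  \<comment> \<open>The map q projects along orbits to the level set; if it were constant, a disc would embed
    in a single orbit by the crossing time.\<close>
  have "\<exists>z\<in>ball p r. q z \<noteq> q p"
  proof (rule ccontr)
    assume "\<not> ?thesis"
    then have const: "q z = q p" if "z \<in> ball p r" for z using that by blast
    have "inj_on \<tau> (ball p r)"
    proof (rule inj_onI)
      fix y z assume yz: "y \<in> ball p r" "z \<in> ball p r" "\<tau> y = \<tau> z"
      have *: "k w = f (- \<tau> w, k (q p))" if "w \<in> ball p r" for w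
        using kq[OF that] const[OF that] flow_on_add[OF flow kM] flow_on_zero[OF flow kM] by simp
      have "k y = k z" using *[OF yz(1)] *[OF yz(2)] yz(3) by simp
      then show "y = z" using k(3) by (simp add: inj_eq)
    qed
    then have "DIM(real^2) \<le> DIM(real)"
      using invariance_of_dimension[OF \<tau>(1)] r(1) by simp
    then show False by simp
  qed
  then obtain z1 where z1: "z1 \<in> ball p r" "q z1 \<noteq> q p" by blast
  have "path_connected (q ` ball p r)"
    by (intro path_connected_continuous_image contq convex_imp_path_connected convex_ball)
  \<comment> \<open>The image of \<open>q\<close> is path connected with two distinct points, so it
    contains an arc, and all of it lies on the level \<open>c\<close>.\<close>
  then obtain \<gamma> where \<gamma>: "arc \<gamma>" "path_image \<gamma> \<subseteq> q ` ball p r"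
    unfolding path_connected_arcwise using z1 r(1) by (metis centre_in_ball image_eqI)
  have \<gamma>d: "dist p (\<gamma> s) < d" "\<Psi> (0, \<gamma> s) = c" if "s \<in> {0..1}" for s
  proof -
    have "\<gamma> s \<in> q ` ball p r" using \<gamma>(2) that by (auto simp: path_image_def)
    then show "dist p (\<gamma> s) < d" "\<Psi> (0, \<gamma> s) = c" using qd q\<Psi> by auto
  qed
  have cont\<gamma>: "continuous_on {0..1} \<gamma>" and inj\<gamma>: "inj_on \<gamma> {0..1}"
    using \<gamma>(1) by (auto simp: arc_def path_def)
  define F where "F = (\<lambda>(s, t). f (t, k (\<gamma> s)))"
  \<comment> \<open>Equal box points put \<open>k (\<gamma> s')\<close> on the orbit of
    \<open>k (\<gamma> s)\<close> at time \<open>t - t'\<close>. Both lie on the level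
    \<open>c\<close>, so strict monotonicity forces the time difference to be zero.\<close>
  have injF: "inj_on F ({0..1} \<times> {-e..e})"
  proof (clarsimp simp: inj_on_def F_def)
    fix s t s' t' :: real
    assume s: "0 \<le> s" "s \<le> 1" "0 \<le> s'" "s' \<le> 1" and t: "-e \<le> t" "t \<le> e" "-e \<le> t'" "t' \<le> e"
      and eq: "f (t, k (\<gamma> s)) = f (t', k (\<gamma> s'))"
    have "f (-t', f (t, k (\<gamma> s))) = f (-t', f (t', k (\<gamma> s')))" by (simp add: eq)
    then have eq': "k (\<gamma> s') = f (t - t', k (\<gamma> s))"
      using flow_on_add[OF flow kM] flow_on_zero[OF flow kM] by simp
    then have "\<Psi> (t - t', \<gamma> s) = \<Psi> (0, \<gamma> s)"
      using cocycle[OF eq', of 0] \<gamma>d(2)[of s] \<gamma>d(2)[of s'] s by simp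
    then have "t - t' = 0"
      using mono[of "t - t'" 0 "\<gamma> s"] mono[of 0 "t - t'" "\<gamma> s"] \<gamma>d(1)[of s] s t e d(1)
      by (smt (verit) atLeastAtMost_iff field_sum_of_halves)
    moreover from this have "\<gamma> s' = \<gamma> s"
      using eq' flow_on_zero[OF flow kM] k(3) by (simp add: inj_eq)
    ultimately show "s = s' \<and> t = t'"
      using inj\<gamma> s by (auto simp: inj_on_def)
  qed
  have contA: "continuous_map (top_of_set {0..1}) M (\<lambda>s. k (\<gamma> s))"
    using continuous_map_compose[OF _ k(1), of "top_of_set {0..1}" \<gamma>] cont\<gamma> by (simp add: o_def)
  have openF: "openin M (F ` S)" if S: "open S" "S \<subseteq> {0<..<1} \<times> {-e<..<e}" for S
  proof -
    have Fk: "F w \<in> range k" if "w \<in> S" for w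
      using that S(2) d(2)[of "snd w" "\<gamma> (fst w)"] \<gamma>d(1)[of "fst w"] e d(1)
      by (force simp: F_def O1_def \<Phi>_def split_def)
    have "continuous_on S (\<lambda>w. (snd w, \<gamma> (fst w)))"
      using S(2) by (intro continuous_intros continuous_on_compose2[OF cont\<gamma>]) auto
    then have "continuous_map (top_of_set S) M F"
      using continuous_map_compose[OF _ \<Phi>, of "top_of_set S" "\<lambda>w. (snd w, \<gamma> (fst w))"]
      by (simp add: o_def F_def \<Phi>_def split_def)
    then have "continuous_map (top_of_set S) (subtopology M (range k)) F"
      using Fk by (fastforce simp: continuous_map_in_subtopology)
    from continuous_map_compose[OF this open_embedding_inv_continuous_map[OF k(1-3)]]
    have "continuous_on S (\<lambda>w. inv k (F w))" by (simp add: o_def)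
    moreover have "inj_on (\<lambda>w. inv k (F w)) S"
    proof (rule inj_onI)
      fix v w assume vw: "v \<in> S" "w \<in> S" "inv k (F v) = inv k (F w)"
      then have "F v = F w" using Fk by (metis f_inv_into_f)
      then show "v = w" using vw S(2) by (intro inj_onD[OF injF]) auto
    qed
    \<comment> \<open>Read in the chart, the box map is a continuous injection from an open subset
      of one plane into another.\<close>
    ultimately have "open ((\<lambda>w. inv k (F w)) ` S)"
      using S(1) by (intro invariance_of_domain_gen) simp_all
    then have "openin M (k ` (\<lambda>w. inv k (F w)) ` S)" by (rule openk)
    moreover have "k ` (\<lambda>w. inv k (F w)) ` S = F ` S"
      unfolding image_image using Fk by (intro image_cong) (auto simp: f_inv_into_f)
    ultimately show ?thesis by simp
  qed
  show ?thesis
    using that[OF e(1) contA] injF openF unfolding F_def by blast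
qed


section \<open>Simple closed loops are circles\<close>

text \<open>The circle is the interval with its ends glued, so the loop factors through it; a
  continuous injection of a compact space into a Hausdorff space is an embedding. The complex circle
  serves as intermediary because \<open>Arg2pi\<close> inverts its parametrization.\<close>

lemma loop_image_homeomorphic_circle:
  assumes haus: "Hausdorff_space M" and \<gamma>: "continuous_map (top_of_set {0..1::real}) M \<gamma>"
    and loop: "\<gamma> 0 = \<gamma> 1"
    and inj: "\<And>s t. s \<in> {0..1} \<Longrightarrow> t \<in> {0..1} \<Longrightarrow> \<gamma> s = \<gamma> t \<Longrightarrow> s = t \<or> {s, t} = {0, 1}"
  shows "subtopology M (\<gamma> ` {0..1}) homeomorphic_space top_of_set (sphere (0 :: real^2) 1)"
proof -
  define c where "c = (\<lambda>s::real. cis (2 * pi * s))"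
  have c01: "c 0 = c 1" by (simp add: c_def)
  have Arg: "Arg2pi (c s) = 2 * pi * s" if "0 \<le> s" "s < 1" for s
    by (rule Arg2pi_unique[where r=1]) (use that in \<open>auto simp: c_def cis_conv_exp\<close>)
  have c_inj: "s = t" if "c s = c t" "0 \<le> s" "s < 1" "0 \<le> t" "t < 1" for s t
  proof -
    have "2 * pi * s = 2 * pi * t" using Arg that by metis
    then show ?thesis by simp
  qed
  have \<gamma>_eq: "\<gamma> s = \<gamma> t" if "s \<in> {0..1}" "t \<in> {0..1}" "c s = c t" for s t
  proof -
    define m where "m = (\<lambda>s::real. if s = 1 then 0 else s)"
    have m: "c (m r) = c r" "\<gamma> (m r) = \<gamma> r" for r using c01 loop by (auto simp: m_def)
    have "m s = m t"
      by (rule c_inj) (use that m(1) in \<open>auto simp: m_def\<close>)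
    then show ?thesis using m(2) by metis
  qed
  have sph: "c ` {0..1} = sphere 0 1"
  proof (intro equalityI subsetI)
    fix z assume "z \<in> sphere (0::complex) 1"
    then have "z = c (Arg2pi z / (2 * pi))"
      using Arg2pi[of z] by (simp add: c_def cis_conv_exp is_Arg_def)
    moreover have "Arg2pi z / (2 * pi) \<in> {0..1}"
      using Arg2pi[of z] by (simp add: field_simps)
    ultimately show "z \<in> c ` {0..1}" by blast
  qed (auto simp: c_def)
  have contc: "continuous_map (top_of_set {0..1}) (top_of_set (sphere 0 1)) c"
    using sph by (auto simp: c_def intro!: continuous_intros)
  have q: "quotient_map (top_of_set {0..1}) (top_of_set (sphere 0 1)) c"
    by (rule T1_Spaces.continuous_imp_quotient_map[OF contc])
       (auto simp: sph compact_space_subtopology compactin_euclidean_iff Hausdorff_space_subtopology)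
  have lift: "\<gamma> s = \<gamma> t" if "s \<in> topspace (top_of_set {0..1})" "t \<in> topspace (top_of_set {0..1})" "c s = c t" for s t
    using that \<gamma>_eq by (metis topspace_euclidean_subtopology)
  obtain h where h: "continuous_map (top_of_set (sphere 0 1)) M h"
      "h ` topspace (top_of_set (sphere 0 1)) = \<gamma> ` topspace (top_of_set {0..1})"
      "\<And>s. s \<in> topspace (top_of_set {0..1}) \<Longrightarrow> h (c s) = \<gamma> s"
    using quotient_map_lift_exists[OF q \<gamma> lift] by blast
  have "inj_on h (sphere 0 1)"
  proof (rule inj_onI)
    fix y z assume yz: "y \<in> sphere 0 1" "z \<in> sphere 0 1" "h y = h z"
    then obtain s t where st: "s \<in> {0..1}" "t \<in> {0..1}" "y = c s" "z = c t"
      using sph by (metis imageE)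
    then have "\<gamma> s = \<gamma> t" using h(3)[of s] h(3)[of t] yz(3) by simp
    then show "y = z" using inj[OF st(1,2)] c01 by (auto simp: st doubleton_eq_iff)
  qed
  then have "embedding_map (top_of_set (sphere 0 1)) M h"
    by (intro continuous_imp_embedding_map[OF h(1) _ haus])
       (auto simp: compact_space_subtopology compactin_euclidean_iff)
  then have "homeomorphic_map (top_of_set (sphere 0 1)) (subtopology M (\<gamma> ` {0..1})) h"
    using h(2) by (simp add: embedding_map_def)
  then have "subtopology M (\<gamma> ` {0..1}) homeomorphic_space top_of_set (sphere (0::complex) 1)"
    using homeomorphic_map_imp_homeomorphic_space homeomorphic_space_sym by blast
  moreover have "top_of_set (sphere (0::complex) 1) homeomorphic_space top_of_set (sphere (0::real^2) 1)"
    using homeomorphic_spheres_gen[of 1 1 "0::complex" "0::real^2"]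
    unfolding homeomorphic_def homeomorphism_def homeomorphic_space_def homeomorphic_maps_def
    by (fastforce simp: Pi_iff)
  ultimately show ?thesis by (rule homeomorphic_space_trans)
qed

section \<open>Flow boxes, crossing times and confinement of the orbit\<close>

text \<open>The coordinate \<open>s\<close> runs along the section and \<open>t\<close> along
  orbits. The assumptions are symmetric in time, so the reversed flow is an instance with the same
  section.\<close>

locale flow_box =
  fixes M :: "'a topology" and f :: "real \<times> 'a \<Rightarrow> 'a" and A :: "real \<Rightarrow> 'a" and e :: real
  assumes flow: "flow_on M f" and hausdorff: "Hausdorff_space M" and e_pos: "e > 0"
    and continuous_section: "continuous_map (top_of_set {0..1}) M A"
    and inj_box: "inj_on (\<lambda>(s, t). f (t, A s)) ({0..1} \<times> {-e..e})"
begin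

lemmas f_add = flow_on_add[OF flow]
lemmas f_zero = flow_on_zero[OF flow]
lemmas f_in = flow_on_in_topspace[OF flow]

lemma section_in: "s \<in> {0..1} \<Longrightarrow> A s \<in> topspace M"
  using continuous_section by (auto simp: continuous_map_def)

lemma box_eqD:
  assumes "f (t, A s) = f (t', A s')" "s \<in> {0..1}" "s' \<in> {0..1}" "\<bar>t\<bar> \<le> e" "\<bar>t'\<bar> \<le> e"
  shows "s = s'" "t = t'"
  using inj_onD[OF inj_box, of "(s, t)" "(s', t')"] assms by (auto simp: abs_le_iff)

text \<open>The flow carries \<open>A s'\<close> to \<open>A s\<close> in time
  \<open>t - t'\<close>, inside the box. Distinct crossings by one injective stretch of orbit are
  therefore more than \<open>e\<close> apart in time.\<close>

lemma crossing_gap: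
  assumes "x \<in> topspace M" "f (t, x) = A s" "f (t', x) = A s'" "s \<in> {0..1}" "s' \<in> {0..1}" "\<bar>t - t'\<bar> \<le> e"
  shows "t = t'"
proof -
  have "f (t - t', f (t', x)) = f (t, x)" using f_add[OF assms(1)] by simp
  then have "f (0, A s) = f (t - t', A s')" using assms f_zero[OF section_in[of s]] by simp
  from box_eqD(2)[OF this] assms e_pos show ?thesis by simp
qed

text \<open>Between consecutive multiples of \<open>e\<close> there is at most one crossing, and
  \<open>{u..v}\<close> meets finitely many of these intervals.\<close>

lemma finite_crossings:
  assumes x: "x \<in> topspace M"
  shows "finite {t \<in> {u..v}. f (t, x) \<in> A ` {0..1}}" (is "finite ?C")
proof -
  have "inj_on (\<lambda>t. \<lfloor>t / e\<rfloor>) ?C"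
  proof (rule inj_onI)
    fix t t' assume t: "t \<in> ?C" "t' \<in> ?C" and eq: "\<lfloor>t / e\<rfloor> = \<lfloor>t' / e\<rfloor>"
    have "\<bar>t / e - t' / e\<bar> < 1" using eq by linarith
    moreover have "t / e - t' / e = (t - t') / e" by (simp add: diff_divide_distrib)
    ultimately have "\<bar>t - t'\<bar> / e < 1" using e_pos by (simp add: abs_divide)
    then have "\<bar>t - t'\<bar> \<le> e" using e_pos by (simp add: field_simps)
    then show "t = t'" using t crossing_gap[OF x] by auto
  qed
  moreover have "(\<lambda>t. \<lfloor>t / e\<rfloor>) ` ?C \<subseteq> {\<lfloor>u / e\<rfloor>..\<lfloor>v / e\<rfloor>}"
    using e_pos by (auto intro!: floor_mono divide_right_mono)
  then have "finite ((\<lambda>t. \<lfloor>t / e\<rfloor>) ` ?C)" using finite_subset by blast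
  ultimately show ?thesis using finite_imageD by blast
qed

lemma reversed: "flow_box M (\<lambda>(t, x). f (- t, x)) A e"
proof
  have "continuous_map (prod_topology euclideanreal M) M (\<lambda>w. f (- fst w, snd w))"
    by (intro flow_on_continuous_map[OF flow]) (auto intro!: continuous_map_fst continuous_map_snd continuous_map_minus)
  moreover have "(\<lambda>w. f (- fst w, snd w)) = (\<lambda>(t, x). f (- t, x))" by auto
  ultimately show "flow_on M (\<lambda>(t, x). f (- t, x))"
    using f_add f_zero by (simp add: flow_on_def)
  show "inj_on (\<lambda>(s, t). (\<lambda>(t, x). f (- t, x)) (t, A s)) ({0..1} \<times> {-e..e})"
  proof (clarsimp simp: inj_on_def)
    fix s t s' t'
    assume eq: "f (- t, A s) = f (- t', A s')"
      and "0 \<le> s" "s \<le> 1" "- e \<le> t" "t \<le> e" "0 \<le> s'" "s' \<le> 1" "- e \<le> t'" "t' \<le> e"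
    then show "s = s' \<and> t = t'" using box_eqD[OF eq] by auto
  qed
qed (use hausdorff e_pos continuous_section in auto)

lemma continuous_orbit: "x \<in> topspace M \<Longrightarrow> continuous_map euclideanreal M (\<lambda>t. f (t, x))"
  by (intro flow_on_continuous_map[OF flow]) auto

lemma closedin_section:
  assumes "a \<in> {0..1}" "b \<in> {0..1}"
  shows "closedin M (A ` closed_segment a b)"
proof -
  have "closed_segment a b \<subseteq> {0..1}" using assms by (simp add: closed_segment_subset)
  then have "compactin (top_of_set {0..1}) (closed_segment a b)"
    by (simp add: compactin_subtopology compactin_euclidean_iff)
  from image_compactin[OF this continuous_section] show ?thesis
    using hausdorff compactin_imp_closedin by blast
qed

text \<open>The fibre over \<open>a\<close> is left out because there the orbit piece of the circle
  leaves the segment. Without this end the base is still an interval, so the strip is a continuous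
  image of a convex set.\<close>

lemma connectedin_strip:
  assumes "a \<in> {0..1}" "b \<in> {0..1}"
  shows "connectedin M ((\<lambda>(s, t). f (t, A s)) ` ((closed_segment a b - {a}) \<times> {0<..<e}))"
proof -
  have sub: "closed_segment a b - {a} \<subseteq> {0..1}" using assms by (meson Diff_subset closed_segment_subset convex_real_interval(5) order_trans)
  have "closed_segment a b - {a} = (if a \<le> b then {a<..b} else {b..<a})"
    by (auto simp: closed_segment_eq_real_ivl)
  then have "convex (closed_segment a b - {a})" by simp
  then have conn: "connected ((closed_segment a b - {a}) \<times> {0<..<e})"
    by (intro convex_connected convex_Times) auto
  let ?S = "(closed_segment a b - {a}) \<times> {0<..<e}"
  have "continuous_map (top_of_set ?S) M (\<lambda>w. f (snd w, A (fst w)))"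
  proof (rule flow_on_continuous_map[OF flow])
    show "continuous_map (top_of_set ?S) M (\<lambda>w. A (fst w))"
      using continuous_map_compose[OF _ continuous_section, of "top_of_set ?S" fst] sub
      by (force simp: o_def intro!: continuous_intros)
  qed (auto intro!: continuous_intros)
  then have "continuous_map (top_of_set ?S) M (\<lambda>(s, t). f (t, A s))" by (simp add: split_def)
  from connectedin_continuous_map_image[OF this, of ?S] conn show ?thesis
    by (simp add: connectedin_subtopology)
qed

text \<open>By injectivity, after \<open>t2\<close> the orbit can meet the circle only on the
  segment, and not at \<open>A a\<close>, its position at \<open>t1\<close>. Every meeting is
  followed by a stay in the strip, hence in \<open>W\<close>, and until the next meeting the orbit
  is a connected set off \<open>J\<close>.\<close>

lemma forward_orbit_confined:
  assumes x: "x \<in> topspace M" and inj: "inj (\<lambda>t. f (t, x))"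
    and ab: "a \<in> {0..1}" "b \<in> {0..1}" and "t1 < t2"
    and fa: "f (t1, x) = A a" and fb: "f (t2, x) = A b"
    and J: "J = (\<lambda>t. f (t, x)) ` {t1..t2} \<union> A ` closed_segment a b"
    and W: "openin M W" "openin M W'" "W \<inter> W' = {}" "W \<union> W' = topspace M - J"
    and strip: "(\<lambda>(s, t). f (t, A s)) ` ((closed_segment a b - {a}) \<times> {0<..<e}) \<subseteq> W"
    and t: "t > t2"
  shows "f (t, x) \<in> W \<union> J"
proof (rule ccontr)
  assume n: "f (t, x) \<notin> W \<union> J"
  have ab': "closed_segment a b \<subseteq> {0..1}" using ab by (simp add: closed_segment_subset)
  define C where "C = {s \<in> {t2..t}. f (s, x) \<in> A ` closed_segment a b}"
  have "closed {s. f (s, x) \<in> A ` closed_segment a b}"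
    using closedin_continuous_map_preimage[OF continuous_orbit[OF x] closedin_section[OF ab]] by simp
  then have "compact ({t2..t} \<inter> {s. f (s, x) \<in> A ` closed_segment a b})"
    by (intro compact_Int_closed) auto
  then have "compact C" by (simp add: C_def Int_def)
  moreover have "t2 \<in> C" using fb t by (auto simp: C_def)
  ultimately obtain m where m: "m \<in> C" "\<And>s. s \<in> C \<Longrightarrow> s \<le> m"
    using compact_attains_sup[of C] by blast
  obtain s where s: "s \<in> closed_segment a b" "f (m, x) = A s" using m(1) by (auto simp: C_def)
  have "m \<noteq> t" using m(1) n by (auto simp: C_def J)
  then have mt: "t2 \<le> m" "m < t" using m(1) by (auto simp: C_def)
  have "s \<noteq> a"
  proof
    assume "s = a"
    then have "m = t1" using s(2) fa by (intro injD[OF inj]) simp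
    then show False using mt \<open>t1 < t2\<close> by simp
  qed
  \<comment> \<open>Just after the last crossing m of the segment the orbit is in the strip.\<close>
  define K where "K = (\<lambda>r. f (r, x)) ` {m<..t}"
  have K1: "connectedin M K"
    unfolding K_def
    by (rule connectedin_continuous_map_image[OF continuous_orbit[OF x]]) simp
  have K2: "K \<subseteq> W \<union> W'"
  proof -
    have "f (r, x) \<notin> J" if "r \<in> {m<..t}" for r
    proof
      assume "f (r, x) \<in> J"
      then consider r' where "r' \<in> {t1..t2}" "f (r, x) = f (r', x)" | "f (r, x) \<in> A ` closed_segment a b"
        by (auto simp: J)
      then show False
      proof cases
        case 1
        then have "r = r'" using injD[OF inj] by blast
        then show False using 1 that mt by auto
      next
        case 2
        then have "r \<in> C" using that mt by (auto simp: C_def)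
        then show False using m(2) that by force
      qed
    qed
    then show ?thesis using W(4) f_in[OF x] by (auto simp: K_def)
  qed
  define u where "u = min t (m + e / 2)"
  have u: "m < u" "u \<le> t" "u - m < e" using mt e_pos by (auto simp: u_def min_def)
  have "f (u, x) = f (u - m, A s)" using f_add[OF x, of "u - m" m] s(2) by simp
  then have "f (u, x) \<in> W" using strip s(1) \<open>s \<noteq> a\<close> u by force
  moreover have "f (u, x) \<in> K" using u by (auto simp: K_def)
  moreover have "f (t, x) \<in> K" using mt by (auto simp: K_def)
  moreover from this have "f (t, x) \<in> W'" using n K2 by blast
  ultimately show False using K1 K2 W(1-3) unfolding connectedin by blast
qed

text \<open>If the strip point over \<open>s\<close> at height \<open>t\<close> lay on the orbit
  piece at time \<open>r\<close>, the orbit would cross the segment at time \<open>r - t\<close>.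
  This time is below \<open>t2\<close> and above \<open>t1 - e\<close>; consecutiveness and the gap
  between crossings leave only \<open>t1\<close>, so \<open>s = a\<close>, which is excluded. The
  segment itself is avoided by injectivity of the box.\<close>

lemma strip_disjoint_loop:
  assumes x: "x \<in> topspace M" and ab: "a \<in> {0..1}" "b \<in> {0..1}"
    and fa: "f (t1, x) = A a"
    and J: "J = (\<lambda>t. f (t, x)) ` {t1..t2} \<union> A ` closed_segment a b"
    and consec: "\<And>t. t1 < t \<Longrightarrow> t < t2 \<Longrightarrow> f (t, x) \<notin> A ` closed_segment a b"
  shows "(\<lambda>(s, t). f (t, A s)) ` ((closed_segment a b - {a}) \<times> {0<..<e}) \<subseteq> topspace M - J"
proof -
  have ab': "closed_segment a b \<subseteq> {0..1}" using ab by (simp add: closed_segment_subset)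
  have "f (t, A s) \<in> topspace M - J" if s: "s \<in> closed_segment a b" "s \<noteq> a" and t: "0 < t" "t < e" for s t
  proof -
    have s01: "s \<in> {0..1}" using s ab' by blast
    have "f (t, A s) \<noteq> A s'" if "s' \<in> closed_segment a b" for s'
    proof
      assume "f (t, A s) = A s'"
      moreover have "s' \<in> {0..1}" using that ab' by blast
      ultimately have "f (t, A s) = f (0, A s')" using f_zero section_in by simp
      from box_eqD(2)[OF this s01 \<open>s' \<in> {0..1}\<close>] t show False by simp
    qed
    moreover have "f (t, A s) \<noteq> f (r, x)" if r: "r \<in> {t1..t2}" for r
    proof
      assume eq: "f (t, A s) = f (r, x)"
      have "A s = f (- t, f (t, A s))" using f_add f_zero section_in[OF s01] by simp
      also have "\<dots> = f (r - t, x)" using eq f_add[OF x] by simp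
      finally have cr: "f (r - t, x) = A s" by simp
      show False
      proof (cases "r - t > t1")
        case True
        then show False using consec[of "r - t"] cr s r t by auto
      next
        case False
        then have "\<bar>r - t - t1\<bar> \<le> e" using r t by auto
        then have "r - t = t1" using crossing_gap[OF x cr fa s01 ab(1)] by simp
        then have "f (0, A s) = f (0, A a)" using cr fa by simp
        from box_eqD(1)[OF this s01 ab(1)] s e_pos show False by simp
      qed
    qed
    ultimately have "f (t, A s) \<notin> J" unfolding J by blast
    then show ?thesis using f_in[OF section_in[OF s01]] by simp
  qed
  then show ?thesis by force
qed

end


section \<open>Dense orbits and the separating circle\<close>

context flow_box
begin

lemma section_eqD: "A s = A s' \<Longrightarrow> s \<in> {0..1} \<Longrightarrow> s' \<in> {0..1} \<Longrightarrow> s = s'"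
  using box_eqD(1)[of 0 s 0 s'] f_zero section_in e_pos by simp

text \<open>Reducing times modulo \<open>p\<close> moves every crossing into \<open>{0..p}\<close>.
  Section parameters are counted, not times, since each crossing recurs with period
  \<open>p\<close>.\<close>

lemma periodic_finite_crossings:
  assumes x: "x \<in> topspace M" and p: "f (p, x) = x" "p > 0"
  shows "finite {s \<in> {0..1}. \<exists>t. f (t, x) = A s}" (is "finite ?P")
proof -
  have n: "f (real n * p, x) = x" for n
  proof (induction n)
    case (Suc n)
    have "f (real (Suc n) * p, x) = f (p, f (real n * p, x))"
      using f_add[OF x] by (simp add: algebra_simps)
    then show ?case using Suc p by simp
  qed (simp add: f_zero x)
  have m: "f (- (real n * p), x) = x" for n
    using f_add[OF x, of "- (real n * p)" "real n * p"] n f_zero[OF x] by simp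
  have i: "f (of_int i * p, x) = x" for i
    using n m by (cases i rule: int_cases2) simp_all
  have "A ` ?P \<subseteq> (\<lambda>t. f (t, x)) ` {t \<in> {0..p}. f (t, x) \<in> A ` {0..1}}"
  proof (clarify)
    fix s t assume s: "s \<in> {0..1}" and t: "f (t, x) = A s"
    define r where "r = t - of_int \<lfloor>t / p\<rfloor> * p"
    have "f (r, f (of_int \<lfloor>t / p\<rfloor> * p, x)) = f (t, x)" using f_add[OF x] by (simp add: r_def)
    then have r: "f (r, x) = A s" using i t by simp
    have "r \<in> {0..p}"
      using floor_divide_lower[OF p(2), of t] floor_divide_upper[OF p(2), of t]
      by (simp add: r_def algebra_simps)
    then show "A s \<in> (\<lambda>t. f (t, x)) ` {t \<in> {0..p}. f (t, x) \<in> A ` {0..1}}"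
      using r s by (intro image_eqI[of _ _ r]) auto
  qed
  then have "finite (A ` ?P)" using finite_crossings[OF x] finite_surj by blast
  moreover have "inj_on A ?P" by (rule inj_onI) (use section_eqD in blast)
  ultimately show ?thesis by (rule finite_imageD)
qed

text \<open>Density makes the orbit enter the open box over \<open>S\<close>; flowing back by the
  box coordinate \<open>t\<close> lands on the section at the same \<open>s\<close>.\<close>

lemma dense_orbit_crossing:
  assumes x: "x \<in> topspace M" and dense: "M closure_of flow_orbit f x = topspace M"
    and open_box: "\<And>S. open S \<Longrightarrow> S \<subseteq> {0<..<1} \<times> {-e<..<e} \<Longrightarrow> openin M ((\<lambda>(s, t). f (t, A s)) ` S)"
    and S: "open S" "S \<subseteq> {0<..<1}" "S \<noteq> {}"
  obtains t s where "s \<in> S" "f (t, x) = A s"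
proof -
  have "openin M ((\<lambda>(s, t). f (t, A s)) ` (S \<times> {-e<..<e}))"
    using S by (intro open_box open_Times) auto
  moreover have "S \<times> {-e<..<e} \<noteq> {}" using S(3) e_pos by auto
  ultimately have "flow_orbit f x \<inter> (\<lambda>(s, t). f (t, A s)) ` (S \<times> {-e<..<e}) \<noteq> {}"
    using dense unfolding dense_intersects_open by blast
  then obtain r s t where r: "s \<in> S" "f (r, x) = f (t, A s)" by (auto simp: flow_orbit_def)
  have s: "A s \<in> topspace M" using r(1) S(2) section_in by fastforce
  have "f (r - t, x) = f (- t, f (r, x))" using f_add[OF x] by simp
  also have "\<dots> = A s" using r(2) f_add[OF s] f_zero[OF s] by simp
  finally show ?thesis using that r(1) by blast
qed

text \<open>A repeated value makes the orbit periodic. Removing the finitely many parameters it hits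
  leaves a nonempty open set of parameters, over which it would still have to cross.\<close>

lemma dense_orbit_inj:
  assumes x: "x \<in> topspace M" and dense: "M closure_of flow_orbit f x = topspace M"
    and open_box: "\<And>S. open S \<Longrightarrow> S \<subseteq> {0<..<1} \<times> {-e<..<e} \<Longrightarrow> openin M ((\<lambda>(s, t). f (t, A s)) ` S)"
  shows "inj (\<lambda>t. f (t, x))"
proof (rule linorder_injI)
  fix t t' :: real assume "t < t'"
  show "f (t, x) \<noteq> f (t', x)"
  proof
    assume eq: "f (t, x) = f (t', x)"
    have "f (t' - t, x) = f (- t, f (t', x))" using f_add[OF x] by simp
    also have "\<dots> = x" using eq[symmetric] f_add[OF x] f_zero[OF x] by simp
    finally have "finite {s \<in> {0..1}. \<exists>t. f (t, x) = A s}" (is "finite ?P")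
      using periodic_finite_crossings[OF x] \<open>t < t'\<close> by simp
    then have "open ({0<..<1} - ?P)" by (intro open_Diff finite_imp_closed) auto
    moreover have "{0<..<1} - ?P \<noteq> {}"
      using \<open>finite ?P\<close> infinite_Ioo[of "0::real" 1] by (metis Diff_eq_empty_iff finite_subset zero_less_one)
    ultimately obtain r s where "s \<in> {0<..<1} - ?P" "f (r, x) = A s"
      using dense_orbit_crossing[OF x dense open_box, of "{0<..<1} - ?P"] by blast
    then show False by auto
  qed
qed

text \<open>The loop follows the orbit piece from \<open>A a\<close> to \<open>A b\<close> and
  returns along the section from \<open>b\<close> to \<open>a\<close>. Each half is injective, and
  consecutiveness keeps the halves apart except at their ends.\<close>

lemma loop_homeomorphic_circle:
  assumes x: "x \<in> topspace M" and inj: "inj (\<lambda>t. f (t, x))"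
    and ab: "a \<in> {0..1}" "b \<in> {0..1}" and t12: "t1 < t2"
    and fa: "f (t1, x) = A a" and fb: "f (t2, x) = A b"
    and consec: "\<And>t. t1 < t \<Longrightarrow> t < t2 \<Longrightarrow> f (t, x) \<notin> A ` closed_segment a b"
  shows "subtopology M ((\<lambda>t. f (t, x)) ` {t1..t2} \<union> A ` closed_segment a b)
    homeomorphic_space top_of_set (sphere (0 :: real^2) 1)"
proof -
  have ab': "closed_segment a b \<subseteq> {0..1}" using ab by (simp add: closed_segment_subset)
  have "a \<noteq> b" using injD[OF inj, of t1 t2] fa fb t12 by auto
  define \<alpha> where "\<alpha> = (\<lambda>s. t1 + 2 * s * (t2 - t1))"
  define \<beta> where "\<beta> = (\<lambda>s. b + (2 * s - 1) * (a - b))"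
  define \<gamma> where "\<gamma> = (\<lambda>s. if s \<le> 1 / 2 then f (\<alpha> s, x) else A (\<beta> s))"
  have \<alpha>im: "\<alpha> ` {0..1/2} = {t1..t2}"
  proof (intro equalityI subsetI)
    fix t assume "t \<in> {t1..t2}"
    then have "(t - t1) / (2 * (t2 - t1)) \<in> {0..1/2}" using t12 by (auto simp: field_simps)
    moreover have cancel: "2 * (c / (2 * d)) * d = c" if "d \<noteq> 0" for c d :: real using that by simp
    have "\<alpha> ((t - t1) / (2 * (t2 - t1))) = t"
      using cancel[of "t2 - t1" "t - t1"] t12 unfolding \<alpha>_def by linarith
    ultimately show "t \<in> \<alpha> ` {0..1/2}" by (metis imageI)
  next
    fix t assume "t \<in> \<alpha> ` {0..1/2}"
    then obtain s where s: "0 \<le> s" "2 * s \<le> 1" "t = \<alpha> s" by auto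
    have "0 \<le> 2 * s * (t2 - t1)" "2 * s * (t2 - t1) \<le> 1 * (t2 - t1)"
      using s t12 by (intro mult_nonneg_nonneg mult_right_mono; simp)+
    then show "t \<in> {t1..t2}" by (auto simp: s \<alpha>_def)
  qed
  have \<beta>im: "\<beta> ` {1/2..1} = closed_segment a b"
  proof (intro equalityI subsetI)
    fix r assume "r \<in> \<beta> ` {1/2..1}"
    then obtain s where "s \<in> {1/2..1}" and rs: "r = \<beta> s" by blast
    then have s: "0 \<le> 2 * s - 1" "2 * s - 1 \<le> 1" by auto
    have "r = (1 - (2 * s - 1)) *\<^sub>R b + (2 * s - 1) *\<^sub>R a"
      by (simp add: rs \<beta>_def algebra_simps)
    then have "r \<in> closed_segment b a" unfolding closed_segment_def using s by blast
    then show "r \<in> closed_segment a b" by (simp add: closed_segment_commute)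
  next
    fix r assume "r \<in> closed_segment a b"
    then have "r \<in> closed_segment b a" by (simp add: closed_segment_commute)
    then obtain u where u: "0 \<le> u" "u \<le> 1" "r = (1 - u) * b + u * a"
      unfolding closed_segment_def by auto
    have "2 * ((u + 1) / 2) - 1 = u" by (simp add: field_simps)
    then have "r = \<beta> ((u + 1) / 2)" unfolding \<beta>_def u(3) by (simp only:) (simp add: algebra_simps)
    moreover have "(u + 1) / 2 \<in> {1/2..1}" using u by simp
    ultimately show "r \<in> \<beta> ` {1/2..1}" by blast
  qed
  have \<alpha>\<beta>: "\<alpha> (1/2) = t2" "\<beta> (1/2) = b" "\<alpha> 0 = t1" "\<beta> 1 = a" by (simp_all add: \<alpha>_def \<beta>_def)
  have half: "f (\<alpha> s, x) = A (\<beta> s)" if "s = 1/2" for s using fb by (simp only: that \<alpha>\<beta>)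
  have im: "\<gamma> ` {0..1} = (\<lambda>t. f (t, x)) ` {t1..t2} \<union> A ` closed_segment a b"
  proof -
    have "{0..1::real} = {0..1/2} \<union> {1/2..1}" by auto
    then have "\<gamma> ` {0..1} = \<gamma> ` {0..1/2} \<union> \<gamma> ` {1/2..1}" by (metis image_Un)
    also have "\<gamma> ` {0..1/2} = (\<lambda>t. f (t, x)) ` \<alpha> ` {0..1/2}" by (simp add: \<gamma>_def image_image)
    also have "\<gamma> ` {1/2..1} = A ` \<beta> ` {1/2..1}"
      unfolding image_image
    proof (rule image_cong[OF refl])
      fix s :: real assume "s \<in> {1/2..1}"
      then show "\<gamma> s = A (\<beta> s)"
        unfolding \<gamma>_def using half[of s] by (metis atLeastAtMost_iff order_antisym)
    qed
    finally show ?thesis by (simp only: \<alpha>im \<beta>im)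
  qed
  have cont: "continuous_map (top_of_set {0..1}) M \<gamma>"
    unfolding \<gamma>_def
  proof (rule continuous_map_cases_le)
    show "continuous_map (subtopology (top_of_set {0..1}) {s \<in> topspace (top_of_set {0..1}). s \<le> 1/2}) M (\<lambda>s. f (\<alpha> s, x))"
      by (rule flow_on_continuous_map[OF flow])
         (auto simp: \<alpha>_def subtopology_subtopology x intro!: continuous_intros)
    have "\<beta> ` {1/2..1} \<subseteq> {0..1}" using \<beta>im ab' by simp
    then have "continuous_map (top_of_set {1/2..1}) (top_of_set {0..1}) \<beta>"
      by (auto simp: \<beta>_def intro!: continuous_intros)
    from continuous_map_compose[OF this continuous_section]
    have "continuous_map (top_of_set {1/2..1}) M (\<lambda>s. A (\<beta> s))" by (simp add: o_def)
    moreover have "{0..1} \<inter> {s \<in> topspace (top_of_set {0..1}). 1/2 \<le> s} = {1/2..1::real}" by auto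
    ultimately show "continuous_map (subtopology (top_of_set {0..1}) {s \<in> topspace (top_of_set {0..1}). 1/2 \<le> s}) M (\<lambda>s. A (\<beta> s))"
      by (simp only: subtopology_subtopology)
  next
    show "f (\<alpha> s, x) = A (\<beta> s)" if "s = 1/2" for s by (rule half[OF that])
  qed (auto intro!: continuous_intros)
  \<comment> \<open>The junction at \<open>b\<close> belongs to the first half. With
    \<open>t\<close> strictly beyond the middle, the only coincidence left is that of the start of
    the loop with its end.\<close>
  have cross: "s = 0 \<and> t = 1"
    if s: "0 \<le> s" "s \<le> 1/2" and t: "1/2 < t" "t \<le> 1" and eq: "f (\<alpha> s, x) = A (\<beta> t)" for s t
  proof -
    have \<alpha>s: "\<alpha> s \<in> {t1..t2}" using \<alpha>im s by fastforce
    have \<beta>t: "\<beta> t \<in> closed_segment a b" using \<beta>im t by fastforce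
    then have "\<not> (t1 < \<alpha> s \<and> \<alpha> s < t2)" using consec[of "\<alpha> s"] eq by auto
    then consider "\<alpha> s = t1" | "\<alpha> s = t2" using \<alpha>s by fastforce
    then show ?thesis
    proof cases
      case 1
      then have "\<beta> t = a" using eq fa section_eqD[of "\<beta> t" a] ab \<beta>t ab' by auto
      then have "(2 * t - 2) * (a - b) = 0" by (simp add: \<beta>_def algebra_simps)
      moreover have "s = 0" using 1 t12 by (simp add: \<alpha>_def)
      ultimately show ?thesis using \<open>a \<noteq> b\<close> by simp
    next
      case 2
      then have "\<beta> t = b" using eq fb section_eqD[of "\<beta> t" b] ab \<beta>t ab' by auto
      then show ?thesis using \<open>a \<noteq> b\<close> t by (simp add: \<beta>_def)
    qed
  qed
  have "subtopology M (\<gamma> ` {0..1}) homeomorphic_space top_of_set (sphere (0 :: real^2) 1)"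
  proof (rule loop_image_homeomorphic_circle[OF hausdorff cont])
    show "\<gamma> 0 = \<gamma> 1" using fa \<alpha>\<beta> by (simp add: \<gamma>_def)
    fix s t :: real assume s: "s \<in> {0..1}" and t: "t \<in> {0..1}" and eq: "\<gamma> s = \<gamma> t"
    consider "s \<le> 1/2" "t \<le> 1/2" | "s \<le> 1/2" "t > 1/2" | "s > 1/2" "t \<le> 1/2" | "s > 1/2" "t > 1/2"
      by linarith
    then show "s = t \<or> {s, t} = {0, 1}"
    proof cases
      case 1
      then have "\<alpha> s = \<alpha> t" using eq by (intro injD[OF inj]) (simp add: \<gamma>_def)
      then show ?thesis using t12 by (simp add: \<alpha>_def)
    next
      case 2
      then show ?thesis using cross[of s t] s t eq by (auto simp: \<gamma>_def)
    next
      case 3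
      then have "t = 0 \<and> s = 1" using cross[of t s] s t eq by (auto simp: \<gamma>_def)
      then show ?thesis by auto
    next
      case 4
      then have "\<beta> s \<in> {0..1}" "\<beta> t \<in> {0..1}" using \<beta>im ab' s t by fastforce+
      then have "\<beta> s = \<beta> t" using eq 4 section_eqD by (simp add: \<gamma>_def)
      then show ?thesis using \<open>a \<noteq> b\<close> by (simp add: \<beta>_def)
    qed
  qed
  then show ?thesis by (simp only: im)
qed

lemma dichotomic_no_dense_orbit:
  assumes dich: "dichotomic M"
    and x: "x \<in> topspace M" and dense: "M closure_of flow_orbit f x = topspace M"
    and open_box: "\<And>S. open S \<Longrightarrow> S \<subseteq> {0<..<1} \<times> {-e<..<e} \<Longrightarrow> openin M ((\<lambda>(s, t). f (t, A s)) ` S)"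
  shows False
proof -
  have crossing: "\<exists>t. \<exists>s\<in>{u<..<v}. f (t, x) = A s" if "0 \<le> u" "u < v" "v \<le> 1" for u v
  proof -
    have "{u<..<v} \<subseteq> {0<..<1}" "{u<..<v} \<noteq> {}" using that by auto
    then show ?thesis using dense_orbit_crossing[OF x dense open_box open_greaterThanLessThan] by metis
  qed
  have inj: "inj (\<lambda>t. f (t, x))" by (rule dense_orbit_inj[OF x dense open_box])
  \<comment> \<open>Crossings in disjoint halves of the section are different points, hence occur at
    different times.\<close>
  obtain r1 r2 where r: "r1 < r2" "f (r1, x) \<in> A ` {0..1}" "f (r2, x) \<in> A ` {0..1}"
  proof -
    obtain t s where t: "s \<in> {0<..<1/2}" "f (t, x) = A s"
      using crossing[of 0 "1/2"] by auto
    obtain t' s' where t': "s' \<in> {1/2<..<1}" "f (t', x) = A s'"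
      using crossing[of "1/2" 1] by auto
    have s: "s \<in> {0..1}" "s' \<in> {0..1}" using t t' by auto
    have "t \<noteq> t'" using section_eqD[OF _ s] t t' by auto
    then show ?thesis using that[of t t'] that[of t' t] t(2) t'(2) s by (metis image_eqI neqE)
  qed
  \<comment> \<open>The crossing times in \<open>{r1<..r2}\<close>: a finite set containing
    \<open>r2\<close>, whose minimum is the next crossing after \<open>r1\<close>.\<close>
  define C where "C = {t \<in> {r1..r2}. f (t, x) \<in> A ` {0..1}} - {r1}"
  have C: "finite C" "r2 \<in> C" using finite_crossings[OF x] r by (auto simp: C_def)
  define t1 where "t1 = r1"
  define t2 where "t2 = Min C"
  have "t2 \<in> C" unfolding t2_def using C by (intro Min_in) auto
  have no: "f (t, x) \<notin> A ` {0..1}" if "t1 < t" "t < t2" for t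
  proof
    assume "f (t, x) \<in> A ` {0..1}"
    then have "t \<in> C" using that \<open>t2 \<in> C\<close> by (auto simp: C_def t1_def)
    then have "t2 \<le> t" unfolding t2_def using C(1) by simp
    then show False using that by simp
  qed
  have t12: "t1 < t2" using \<open>t2 \<in> C\<close> by (auto simp: C_def t1_def)
  obtain a where a: "a \<in> {0..1}" "f (t1, x) = A a" using r(2) by (auto simp: t1_def)
  obtain b where b: "b \<in> {0..1}" "f (t2, x) = A b" using \<open>t2 \<in> C\<close> by (auto simp: C_def)
  have "a \<noteq> b" using injD[OF inj, of t1 t2] a b t12 by auto
  have ab': "closed_segment a b \<subseteq> {0..1}" using a b by (simp add: closed_segment_subset)
  have consec: "f (t, x) \<notin> A ` closed_segment a b" if "t1 < t" "t < t2" for t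
    using no[OF that] ab' by blast
  define J where "J = (\<lambda>t. f (t, x)) ` {t1..t2} \<union> A ` closed_segment a b"
  \<comment> \<open>For the reversed flow the piece runs from \<open>A b\<close> at time
    \<open>- t2\<close> to \<open>A a\<close> at time \<open>- t1\<close> along the same circle, so
    \<open>a\<close> and \<open>b\<close> change roles.\<close>
  interpret rev: flow_box M "\<lambda>(t, x). f (- t, x)" A e by (rule reversed)
  have "(\<lambda>t. f (- t, x)) ` {-t2..-t1} = (\<lambda>t. f (t, x)) ` uminus ` {-t2..-t1}" by (simp only: image_image)
  also have "uminus ` {-t2..-t1} = {t1..t2}" by simp
  finally have Jrev: "J = (\<lambda>t. (\<lambda>(t, x). f (- t, x)) (t, x)) ` {-t2..-t1} \<union> A ` closed_segment b a"
    by (simp add: J_def closed_segment_commute)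
  have Jtop: "J \<subseteq> topspace M" using f_in[OF x] section_in ab' by (auto simp: J_def)
  have "compactin M ((\<lambda>t. f (t, x)) ` {t1..t2})"
    by (rule image_compactin[OF _ continuous_orbit[OF x]]) (simp add: compactin_euclidean_iff)
  then have Jcl: "closedin M J"
    unfolding J_def using compactin_imp_closedin[OF hausdorff] closedin_section[OF a(1) b(1)] by (simp add: closedin_Un)
  have "subtopology M J homeomorphic_space top_of_set (sphere (0 :: real^2) 1)"
    unfolding J_def by (rule loop_homeomorphic_circle[OF x inj a(1) b(1) t12 a(2) b(2) consec])
  then have "\<not> connectedin M (topspace M - J)" using dich Jtop unfolding dichotomic_def by blast
  then obtain E1 E2 where E: "openin M E1" "openin M E2" "topspace M - J \<subseteq> E1 \<union> E2"
      "E1 \<inter> E2 \<inter> (topspace M - J) = {}" "E1 \<inter> (topspace M - J) \<noteq> {}" "E2 \<inter> (topspace M - J) \<noteq> {}"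
    unfolding connectedin by blast
  define up where "up = (\<lambda>(s, t). f (t, A s)) ` ((closed_segment a b - {a}) \<times> {0<..<e})"
  define low where "low = (\<lambda>(s, t). (\<lambda>(t, x). f (- t, x)) (t, A s)) ` ((closed_segment b a - {b}) \<times> {0<..<e})"
  have up: "connectedin M up" "up \<subseteq> topspace M - J"
    unfolding up_def
    by (rule connectedin_strip[OF a(1) b(1)], rule strip_disjoint_loop[OF x a(1) b(1) a(2) J_def consec])
  have low: "connectedin M low" "low \<subseteq> topspace M - J"
    unfolding low_def
  proof (rule rev.connectedin_strip[OF b(1) a(1)], rule rev.strip_disjoint_loop[OF x b(1) a(1) _ Jrev])
    show "(\<lambda>(t, x). f (- t, x)) (- t2, x) = A b" using b(2) by simp
    show "(\<lambda>(t, x). f (- t, x)) (t, x) \<notin> A ` closed_segment b a" if "- t2 < t" "t < - t1" for t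
      using consec[of "- t"] that by (simp add: closed_segment_commute)
  qed
  \<comment> \<open>\<open>W\<close> names the part that contains the upper strip; the two sets of
    the separation are swapped if necessary.\<close>
  obtain W W' where W: "openin M W" "openin M W'" "W \<inter> W' = {}" "W \<union> W' = topspace M - J"
      "W' \<noteq> {}" "up \<subseteq> W"
  proof -
    let ?P = "E1 - J" and ?Q = "E2 - J"
    have PQ: "openin M ?P" "openin M ?Q" "?P \<inter> ?Q = {}" "?P \<union> ?Q = topspace M - J" "?P \<noteq> {}" "?Q \<noteq> {}"
      using E openin_diff[OF _ Jcl] openin_subset[OF E(1)] openin_subset[OF E(2)] by auto
    have "up \<subseteq> ?P \<or> up \<subseteq> ?Q"
    proof (rule ccontr)
      assume "\<not> ?thesis"
      then have "?P \<inter> up \<noteq> {}" "?Q \<inter> up \<noteq> {}" using up(2) PQ(4) by blast+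
      moreover have "up \<subseteq> ?P \<union> ?Q" "?P \<inter> ?Q \<inter> up = {}" using up(2) PQ(3,4) by auto
      ultimately show False using up(1) PQ(1,2) unfolding connectedin by blast
    qed
    moreover have "?Q \<inter> ?P = {}" "?Q \<union> ?P = topspace M - J" using PQ(3,4) by auto
    ultimately show ?thesis
      using that[OF PQ(1-4,6)] that[OF PQ(2,1) _ _ PQ(5)] by blast
  qed
  have fwd: "f (t, x) \<in> W \<union> J" if "t > t2" for t
    by (rule forward_orbit_confined[OF x inj a(1) b(1) t12 a(2) b(2) J_def W(1-4) _ that])
       (use W(6) in \<open>simp only: up_def\<close>)
  \<comment> \<open>The splitting is kept arbitrary because the lower strip may lie in either
    part.\<close>
  have bwd: "f (t, x) \<in> V \<union> J"
    if V: "openin M V" "openin M V'" "V \<inter> V' = {}" "V \<union> V' = topspace M - J" "low \<subseteq> V" and "t < t1" for t V V'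
  proof -
    have "inj (\<lambda>t. f (- t, x))" using injD[OF inj] by (intro injI) force
    then have "(\<lambda>(t, x). f (- t, x)) (- t, x) \<in> V \<union> J"
      using rev.forward_orbit_confined[OF x _ b(1) a(1) _ _ _ Jrev V(1-4), of "- t"] t12 a(2) b(2) V(5) \<open>t < t1\<close>
      unfolding low_def by simp
    then show ?thesis by simp
  qed
  have "low \<subseteq> W \<or> low \<subseteq> W'"
  proof (rule ccontr)
    assume "\<not> ?thesis"
    then have "W \<inter> low \<noteq> {}" "W' \<inter> low \<noteq> {}" using low(2) W(4) by blast+
    then show False using low W(1-4) unfolding connectedin by blast
  qed
  then show False
  proof
    assume lowW: "low \<subseteq> W"
    have "flow_orbit f x \<inter> W' \<noteq> {}"
      using dense W(2,5) unfolding dense_intersects_open by blast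
    then obtain t where t: "f (t, x) \<in> W'" by (auto simp: flow_orbit_def)
    have "f (t, x) \<in> W \<union> J"
      using fwd[of t] bwd[OF W(1-4) lowW, of t] by (cases "t > t2"; cases "t < t1") (auto simp: J_def)
    then show False using t W(3,4) by blast
  next
    assume lowW': "low \<subseteq> W'"
    have W'c: "W' \<inter> W = {}" "W' \<union> W = topspace M - J" using W(3,4) by auto
    have "0 \<le> min a b" "min a b < max a b" "max a b \<le> 1"
      using a(1) b(1) \<open>a \<noteq> b\<close> by (auto simp: min_def max_def)
    \<comment> \<open>Density yields a crossing strictly inside the segment. Its time is neither
      \<open>t1\<close> nor \<open>t2\<close>, and not between them, as these are
      consecutive.\<close>
    then obtain t s where t: "s \<in> {min a b<..<max a b}" "f (t, x) = A s"
      using crossing by blast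
    have s: "s \<in> closed_segment a b" "s \<noteq> a" "s \<noteq> b"
      using t(1) by (auto simp: closed_segment_eq_real_ivl min_def max_def split: if_splits)
    have s01: "s \<in> {0..1}" using s(1) ab' by blast
    have "t \<noteq> t1" "t \<noteq> t2" using section_eqD[OF _ s01] a b t(2) s by auto
    then consider "t > t2" | "t < t1" using consec[of t] t(2) s(1) by force
    then show False
    proof cases
      case 1
      \<comment> \<open>Halving keeps \<open>t - u\<close> after \<open>t2\<close> and
        \<open>u\<close> within the box. Just before this crossing the orbit is in the lower strip,
        hence in \<open>W'\<close>, although after \<open>t2\<close> it is confined to
        \<open>W \<union> J\<close>.\<close>
      define u where "u = min ((t - t2) / 2) (e / 2)"
      have u: "0 < u" "u < e" "t - u > t2" using 1 e_pos by (auto simp: u_def min_def field_simps)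
      have "f (- u, A s) = f (t - u, x)" using f_add[OF x, of "- u" t] t(2) by simp
      moreover have "f (- u, A s) \<in> low"
        unfolding low_def using s u by (intro image_eqI[of _ _ "(s, u)"]) (auto simp: closed_segment_commute)
      ultimately show False using fwd[OF u(3)] lowW' low(2) W(3) by auto
    next
      case 2
      \<comment> \<open>Mirror image: just after the crossing and still before \<open>t1\<close> the
        orbit is in the upper strip, hence in \<open>W\<close>, while its past is confined to
        \<open>W' \<union> J\<close>.\<close>
      define u where "u = min ((t1 - t) / 2) (e / 2)"
      have u: "0 < u" "u < e" "t + u < t1" using 2 e_pos by (auto simp: u_def min_def field_simps)
      have "f (u, A s) = f (t + u, x)" using f_add[OF x, of u t] t(2) by (simp add: add.commute)
      moreover have "f (u, A s) \<in> up"
        unfolding up_def using s u by (intro image_eqI[of _ _ "(s, u)"]) auto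
      ultimately show False using bwd[OF W(2,1) W'c lowW' u(3)] W(3,6) up(2) by auto
    qed
  qed
qed

end

theorem lemma5p2:
  fixes M :: "'a topology"
  assumes "surface M" and "dichotomic M"
  shows "intransitive M"
  unfolding intransitive_def
proof
  assume "\<exists>f. transitive_flow M f"
  then obtain f x where flow: "flow_on M f" and x: "x \<in> topspace M"
    and dense: "M closure_of flow_orbit f x = topspace M"
    unfolding transitive_flow_def by blast
  have haus: "Hausdorff_space M" using assms(1) by (simp add: surface_def)
  \<comment> \<open>A fixed point is its own orbit and is closed, so density would shrink the
    surface to one point, while a chart has many.\<close>
  have "\<exists>t. f (t, x) \<noteq> x"
  proof (rule ccontr)
    assume "\<not> ?thesis"
    moreover have "flow_orbit f x = (\<lambda>t. f (t, x)) ` UNIV" by (auto simp: flow_orbit_def)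
    ultimately have "flow_orbit f x = {x}" by auto
    then have "topspace M = {x}"
      using dense closedin_Hausdorff_sing_eq[OF haus, of x] x closure_of_closedin by metis
    moreover obtain k :: "real^2 \<Rightarrow> 'a" where "continuous_map euclidean M k" "inj k"
      using surface_chart[OF assms(1) x] by blast
    ultimately have "k 0 = k 1" "inj k" by (auto simp: continuous_map_def Pi_iff)
    then show False by (simp add: inj_eq)
  qed
  then obtain t where "f (t, x) \<noteq> x" by blast
  then show False
  proof (rule exists_local_section[OF assms(1) flow x])
    fix A :: "real \<Rightarrow> 'a" and e :: real
    assume A: "e > 0" "continuous_map (top_of_set {0..1}) M A"
      "inj_on (\<lambda>(s, t). f (t, A s)) ({0..1} \<times> {-e..e})"
      and open_box: "\<And>S. open S \<Longrightarrow> S \<subseteq> {0<..<1} \<times> {-e<..<e} \<Longrightarrow> openin M ((\<lambda>(s, t). f (t, A s)) ` S)"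
    interpret flow_box M f A e
      by unfold_locales (fact flow haus A)+
    show False by (rule dichotomic_no_dense_orbit[OF assms(2) x dense open_box])
  qed
qed

end
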